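(* Let $r$ and $n$ be positive integers. Then $$\zeta_{q,r}(1-n,w\mid w_1,\dots,w_r)=(-1)^r\frac{(n-1)!}{(n+r-1)!}\,B^{(r)}_{n+r-1}(w:q\mid w_1,\dots,w_r).$$
   Context: Let $q\in\mathbb{C}$ with $0<|q|<1$, fix a value of $\log q$, and put $q^x=\exp(x\log q)$, $[x]=\frac{1-q^x}{1-q}$. Let $w,w_1,\dots,w_r\in\mathbb{C}$ with $\operatorname{Re}(w)>0$, $w_i\ne0$ and $|q^{w_i}|<1$ for all $i$. The Barnes' type multiple Changhee $q$-Bernoulli polynomials $B^{(r)}_n(w:q\mid w_1,\dots,w_r)$ ($n\ge0$) are defined by $$(-t)^r\Big(\prod_{i=1}^r w_i\Big)\sum_{n_1,\dots,n_r=0}^{\infty}q^{w+n_1w_1+\cdots+n_rw_r}e^{[w+n_1w_1+\cdots+n_rw_r]t}=\sum_{n=0}^{\infty}B^{(r)}_n(w:q\mid w_1,\dots,w_r)\frac{t^n}{n!}.$$ The Barnes' type Changhee multiple $q$-zeta function is $$\zeta_{q,r}(s,w\mid w_1,\dots,w_r)=\Big(\prod_{i=1}^r w_i\Big)\sum_{n_1,\dots,n_r=0}^{\infty}\frac{q^{w+n_1w_1+\cdots+n_rw_r}}{[w+n_1w_1+\cdots+n_rw_r]^s}.$$ At $s=1-n$ with $n\ge1$ an integer, $[x]^{-s}$ is the ordinary power $[x]^{n-1}$ (with $0^0=1$). *)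

theory Defs
  imports "HOL-Analysis.Analysis"
begin

text \<open>
  The value \<open>lq\<close> is the fixed logarithm of \<open>q\<close>, so \<open>exp lq = q\<close> is assumed wherever
  these notions are used; every complex power of \<open>q\<close> refers to it, and not to the
  principal branch used by \<open>powr\<close>.
\<close>

definition q_pow :: "complex \<Rightarrow> complex \<Rightarrow> complex" where
  "q_pow lq x = exp (x * lq)"

definition q_number :: "complex \<Rightarrow> complex \<Rightarrow> complex \<Rightarrow> complex" where
  "q_number q lq x = (1 - q_pow lq x) / (1 - q)"

text \<open>
  Principal complex power, except that \<open>0\<close> to the power \<open>0\<close> is \<open>1\<close> (whereas
  \<open>0 powr 0 = 0\<close>). At every exponent \<open>of_nat k\<close> this is the ordinary power \<open>z ^ k\<close>,
  including at \<open>z = 0\<close>, which can occur as a \<open>q\<close>-number when \<open>q\<close> is not real.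
\<close>

definition complex_power :: "complex \<Rightarrow> complex \<Rightarrow> complex" where
  "complex_power z a = (if z = 0 \<and> a = 0 then 1 else z powr a)"

text \<open>
  The weights are \<open>ws 1, \<dots>, ws r\<close>. A multi-index is a function on \<open>{1..r}\<close>, extended
  by \<open>undefined\<close> outside, so that each tuple is counted exactly once.
\<close>

definition multi_indices :: "nat \<Rightarrow> (nat \<Rightarrow> nat) set" where
  "multi_indices r = ({1..r} \<rightarrow>\<^sub>E UNIV)"

definition barnes_arg :: "nat \<Rightarrow> complex \<Rightarrow> (nat \<Rightarrow> complex) \<Rightarrow> (nat \<Rightarrow> nat) \<Rightarrow> complex" where
  "barnes_arg r w ws m = w + (\<Sum>i=1..r. of_nat (m i) * ws i)"

definition changhee_gen_fun ::
  "complex \<Rightarrow> complex \<Rightarrow> nat \<Rightarrow> complex \<Rightarrow> (nat \<Rightarrow> complex) \<Rightarrow> complex \<Rightarrow> complex" where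
  "changhee_gen_fun q lq r w ws t =
     (- t) ^ r * (\<Prod>i=1..r. ws i) *
     (\<Sum>\<^sub>\<infinity>m\<in>multi_indices r.
        q_pow lq (barnes_arg r w ws m) * exp (q_number q lq (barnes_arg r w ws m) * t))"

text \<open>
  For \<open>0 < \<bar>q\<bar> < 1\<close> and \<open>\<bar>q_pow lq (ws i)\<bar> < 1\<close> the \<open>q\<close>-numbers occurring here are
  bounded and the series converges absolutely, locally uniformly in \<open>t\<close>. The generating
  function is then entire, so exactly one sequence satisfies the defining equation.
\<close>

definition changhee_q_bernoulli ::
  "complex \<Rightarrow> complex \<Rightarrow> nat \<Rightarrow> complex \<Rightarrow> (nat \<Rightarrow> complex) \<Rightarrow> nat \<Rightarrow> complex" where
  "changhee_q_bernoulli q lq r w ws =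
     (THE B. \<forall>t. (\<lambda>n. B n * t ^ n / fact n) sums changhee_gen_fun q lq r w ws t)"

definition changhee_q_zeta ::
  "complex \<Rightarrow> complex \<Rightarrow> nat \<Rightarrow> complex \<Rightarrow> complex \<Rightarrow> (nat \<Rightarrow> complex) \<Rightarrow> complex" where
  "changhee_q_zeta q lq r s w ws =
     (\<Prod>i=1..r. ws i) *
     (\<Sum>\<^sub>\<infinity>m\<in>multi_indices r.
        q_pow lq (barnes_arg r w ws m) *
        complex_power (q_number q lq (barnes_arg r w ws m)) (- s))"

end

theory Submission imports Defs begin

text \<open>
  Write \<open>x\<^sub>m = w + m\<^sub>1 w\<^sub>1 + \<cdots> + m\<^sub>r w\<^sub>r\<close>. Expanding each exponential of the generating function and
  exchanging the two sums gives
  \<open>(- t)^r (\<Prod>w\<^sub>i) \<Sum>\<^sub>k c\<^sub>k t^k / k!\<close>, where \<open>c\<^sub>k = \<Sum>\<^sub>m q^(x\<^sub>m) [x\<^sub>m]^k\<close>; and \<open>(\<Prod>w\<^sub>i) c\<^sub>k\<close> is by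
  definition the zeta value at \<open>s = - k\<close>. The factor \<open>(- t)^r\<close> shifts the coefficients by \<open>r\<close>
  places, so that for \<open>k = n - 1\<close> the zeta value appears in the coefficient of \<open>t^(n + r - 1)\<close>,
  with the sign \<open>(- 1)^r\<close> and with \<open>1 / (n - 1)!\<close> in place of the \<open>1 / (n + r - 1)!\<close> that normalises
  the Bernoulli polynomials.

  Three points need an argument. The exchange of sums (\<open>exp_family_sums\<close>) is Fubini's theorem for
  absolutely convergent double series. It applies because the coefficients \<open>q^(x\<^sub>m)\<close> are absolutely
  summable, being products of geometric sequences of ratio \<open>q^(w\<^sub>i)\<close>
  (\<open>summable_norm_q_pow_barnes_arg\<close>), and because the \<open>q\<close>-numbers \<open>[x\<^sub>m]\<close> are bounded
  (\<open>norm_q_number_barnes_arg_le\<close>). Finally, the Bernoulli polynomials are given by a definite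
  description, so reading off coefficients rests on the uniqueness of power series coefficients
  (\<open>powser_coeffs_unique\<close>).
\<close>

lemma powser_coeffs_unique:
  fixes a b :: "nat \<Rightarrow> complex"
  assumes a: "\<And>t. (\<lambda>n. a n * t ^ n) sums f t"
    and b: "\<And>t. (\<lambda>n. b n * t ^ n) sums f t"
  shows "a = b"
proof -
  have radius: "fps_conv_radius (Abs_fps c) = \<infinity>"
    if "\<And>t. (\<lambda>n. c n * t ^ n) sums f t" for c :: "nat \<Rightarrow> complex"
    using that by (auto simp: fps_conv_radius_def sums_iff intro!: conv_radius_inftyI'')
  have "Abs_fps a = Abs_fps b"
  proof (rule eval_fps_eqD)
    show "fps_conv_radius (Abs_fps a) > 0" "fps_conv_radius (Abs_fps b) > 0"
      using radius[OF a] radius[OF b] by simp_all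
    show "\<forall>\<^sub>F z in nhds 0. eval_fps (Abs_fps a) z = eval_fps (Abs_fps b) z"
      using a b by (simp add: eval_fps_def sums_iff)
  qed
  then show ?thesis
    by (metis fps_nth_Abs_fps ext)
qed

text \<open>
  The norms of the terms \<open>c m * (b m * t) ^ k / fact k\<close> sum over \<open>k\<close> to
  \<open>norm (c m) * exp (norm (b m * t))\<close>. Boundedness of \<open>b\<close> makes the second factor bounded in \<open>m\<close>,
  so the double series converges absolutely and may be summed in either order.
\<close>
lemma exp_family_sums:
  fixes c b :: "'a \<Rightarrow> complex" and t :: complex
  assumes c: "(\<lambda>m. norm (c m)) summable_on A"
    and b: "\<And>m. m \<in> A \<Longrightarrow> norm (b m) \<le> M"
  shows "(\<lambda>k. (\<Sum>\<^sub>\<infinity>m\<in>A. c m * b m ^ k) * t ^ k / fact k) sums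
           (\<Sum>\<^sub>\<infinity>m\<in>A. c m * exp (b m * t))"
proof -
  let ?f = "\<lambda>m k. c m * ((b m * t) ^ k / fact k)"
  have exp_norm: "((\<lambda>k. norm (?f m k)) has_sum norm (c m) * exp (norm (b m * t))) UNIV" for m
  proof -
    have "(\<lambda>k. norm (b m * t) ^ k / fact k) sums exp (norm (b m * t))"
      using exp_converges[of "norm (b m * t)"] by (simp add: divide_inverse mult.commute)
    then have "((\<lambda>k. norm (b m * t) ^ k / fact k) has_sum exp (norm (b m * t))) UNIV"
      by (intro norm_summable_imp_has_sum) (auto simp: sums_iff)
    from has_sum_cmult_right[OF this, of "norm (c m)"] show ?thesis
      by (simp add: norm_mult norm_divide norm_power)
  qed
  have exp_sum: "(\<Sum>\<^sub>\<infinity>k. ?f m k) = c m * exp (b m * t)" for m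
  proof -
    have "(\<lambda>k. (b m * t) ^ k / fact k) sums exp (b m * t)"
      using exp_converges[of "b m * t"] by (simp add: scaleR_conv_of_real divide_inverse mult.commute)
    moreover have "summable (\<lambda>k. norm ((b m * t) ^ k / fact k))"
      using summable_norm_exp[of "b m * t"] by (simp add: norm_mult norm_inverse norm_power divide_inverse mult.commute)
    ultimately have "((\<lambda>k. (b m * t) ^ k / fact k) has_sum exp (b m * t)) UNIV"
      by (intro norm_summable_imp_has_sum)
    from has_sum_cmult_right[OF this, of "c m"] show ?thesis
      by (rule infsumI)
  qed
  have "(\<lambda>m. norm (norm (c m) * exp (norm (b m * t)))) summable_on A"
  proof (rule Infinite_Sum.abs_summable_on_comparison_test')
    show "(\<lambda>m. norm (c m) * exp (M * norm t)) summable_on A"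
      using c by (rule summable_on_cmult_left)
    show "norm (norm (c m) * exp (norm (b m * t))) \<le> norm (c m) * exp (M * norm t)"
      if "m \<in> A" for m
      using b[OF that] by (auto simp: norm_mult intro!: mult_left_mono mult_right_mono)
  qed
  then have "(\<lambda>p. norm (case p of (m, k) \<Rightarrow> ?f m k)) summable_on A \<times> UNIV"
    unfolding Infinite_Sum.abs_summable_on_Sigma_iff
    using has_sum_imp_summable[OF exp_norm] infsumI[OF exp_norm]
    by simp
  then have summable: "(\<lambda>(m, k). ?f m k) summable_on A \<times> UNIV"
    by (rule abs_summable_summable)
  have summable_swap: "(\<lambda>(k, m). ?f m k) summable_on UNIV \<times> A"
    using summable summable_on_swap[of "\<lambda>(m, k). ?f m k" A UNIV] by (simp add: case_prod_unfold)
  have "(\<lambda>k. \<Sum>\<^sub>\<infinity>m\<in>A. ?f m k) summable_on UNIV"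
    using summable_on_Sigma_banach[OF summable_swap] by simp
  then have "(\<lambda>k. \<Sum>\<^sub>\<infinity>m\<in>A. ?f m k) sums (\<Sum>\<^sub>\<infinity>k. \<Sum>\<^sub>\<infinity>m\<in>A. ?f m k)"
    by (intro has_sum_imp_sums has_sum_infsum)
  moreover have "(\<Sum>\<^sub>\<infinity>k. \<Sum>\<^sub>\<infinity>m\<in>A. ?f m k) = (\<Sum>\<^sub>\<infinity>m\<in>A. c m * exp (b m * t))"
    using infsum_swap_banach[OF summable] exp_sum by simp
  moreover have "(\<Sum>\<^sub>\<infinity>m\<in>A. ?f m k) = (\<Sum>\<^sub>\<infinity>m\<in>A. c m * b m ^ k) * t ^ k / fact k" for k
  proof -
    have "(\<Sum>\<^sub>\<infinity>m\<in>A. ?f m k) = (\<Sum>\<^sub>\<infinity>m\<in>A. c m * b m ^ k * (t ^ k / fact k))"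
      by (intro infsum_cong) (simp add: power_mult_distrib)
    then show ?thesis
      unfolding infsum_cmult_left' by simp
  qed
  ultimately show ?thesis
    by simp
qed

lemma norm_q_pow_barnes_arg:
  "norm (q_pow lq (barnes_arg r w ws m)) =
     norm (q_pow lq w) * (\<Prod>i=1..r. norm (q_pow lq (ws i)) ^ m i)"
  by (simp add: q_pow_def barnes_arg_def distrib_right exp_add sum_distrib_right exp_sum
      norm_mult prod_norm [symmetric] mult.assoc exp_of_nat_mult norm_power)

lemma summable_norm_q_pow_barnes_arg:
  assumes "\<forall>i\<in>{1..r}. norm (q_pow lq (ws i)) < 1"
  shows "(\<lambda>m. norm (q_pow lq (barnes_arg r w ws m))) summable_on multi_indices r"
proof -
  have "(\<lambda>k. norm (q_pow lq (ws i)) ^ k) summable_on UNIV" if "i \<in> {1..r}" for i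
    using assms that by (intro norm_summable_imp_summable_on) (simp add: summable_geometric)
  then have "Infinite_Set_Sum.abs_summable_on
      (\<lambda>m. \<Prod>i=1..r. norm (q_pow lq (ws i)) ^ m i) (multi_indices r)"
    unfolding multi_indices_def
    by (intro abs_summable_on_prod_PiE) (auto simp flip: abs_summable_equivalent simp: norm_power)
  then have "(\<lambda>m. \<Prod>i=1..r. norm (q_pow lq (ws i)) ^ m i) summable_on multi_indices r"
    unfolding abs_summable_equivalent [symmetric] by (rule abs_summable_summable)
  then show ?thesis
    unfolding norm_q_pow_barnes_arg by (rule summable_on_cmult_right)
qed

text \<open>
  Moving the index away from \<open>0\<close> only multiplies \<open>q_pow lq w\<close> by factors inside the unit disc, so
  the bound does not depend on \<open>m\<close>.
\<close>
lemma norm_q_number_barnes_arg_le: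
  assumes "\<forall>i\<in>{1..r}. norm (q_pow lq (ws i)) < 1"
  shows "norm (q_number q lq (barnes_arg r w ws m)) \<le> (1 + norm (q_pow lq w)) / norm (1 - q)"
proof -
  have "(\<Prod>i=1..r. norm (q_pow lq (ws i)) ^ m i) \<le> 1"
    using assms by (intro prod_le_1 conjI power_le_one) (simp_all add: less_imp_le)
  then have "norm (q_pow lq (barnes_arg r w ws m)) \<le> norm (q_pow lq w)"
    unfolding norm_q_pow_barnes_arg by (rule mult_left_le) simp
  then have "norm (1 - q_pow lq (barnes_arg r w ws m)) \<le> 1 + norm (q_pow lq w)"
    using norm_triangle_ineq4[of 1 "q_pow lq (barnes_arg r w ws m)"] by simp
  then show ?thesis
    unfolding q_number_def norm_divide by (rule divide_right_mono) simp
qed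

text \<open>
  Up to the product of the weights \<open>ws i\<close>, this is the zeta value at \<open>- k\<close>, and also the coefficient
  of \<open>t ^ k / fact k\<close> in the part of the generating function that follows \<open>(- t) ^ r\<close>.
\<close>
definition q_moment ::
  "complex \<Rightarrow> complex \<Rightarrow> nat \<Rightarrow> complex \<Rightarrow> (nat \<Rightarrow> complex) \<Rightarrow> nat \<Rightarrow> complex" where
  "q_moment q lq r w ws k =
     (\<Sum>\<^sub>\<infinity>m\<in>multi_indices r.
        q_pow lq (barnes_arg r w ws m) * q_number q lq (barnes_arg r w ws m) ^ k)"

text \<open>
  Multiplication by \<open>(- t) ^ r\<close> sends the term of index \<open>k\<close> to index \<open>k + r\<close>; the quotient of
  factorials rewrites \<open>1 / fact k\<close> relative to the new normalisation \<open>1 / fact (k + r)\<close>.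
\<close>
lemma changhee_gen_fun_sums:
  assumes "\<forall>i\<in>{1..r}. norm (q_pow lq (ws i)) < 1"
  shows "(\<lambda>n. (if n < r then 0
               else (- 1) ^ r * (\<Prod>i=1..r. ws i) * (fact n / fact (n - r)) * q_moment q lq r w ws (n - r))
              * t ^ n / fact n) sums changhee_gen_fun q lq r w ws t"
    (is "?f sums _")
proof -
  have "(\<lambda>k. q_moment q lq r w ws k * t ^ k / fact k) sums
          (\<Sum>\<^sub>\<infinity>m\<in>multi_indices r.
             q_pow lq (barnes_arg r w ws m) * exp (q_number q lq (barnes_arg r w ws m) * t))"
    unfolding q_moment_def
    using summable_norm_q_pow_barnes_arg[OF assms] norm_q_number_barnes_arg_le[OF assms]
    by (rule exp_family_sums)
  from sums_mult[OF this, of "(- t) ^ r * (\<Prod>i=1..r. ws i)"]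
  have "(\<lambda>k. (- t) ^ r * (\<Prod>i=1..r. ws i) * (q_moment q lq r w ws k * t ^ k / fact k)) sums
          changhee_gen_fun q lq r w ws t"
    by (simp add: changhee_gen_fun_def)
  also have "(\<lambda>k. (- t) ^ r * (\<Prod>i=1..r. ws i) * (q_moment q lq r w ws k * t ^ k / fact k)) =
               (\<lambda>k. ?f (k + r))"
    by (auto simp: fun_eq_iff power_add power_minus[of t] field_simps)
  finally show ?thesis
    by (subst (asm) sums_iff_shift) simp
qed

lemma changhee_q_bernoulli_eq:
  assumes "\<forall>i\<in>{1..r}. norm (q_pow lq (ws i)) < 1"
  shows "changhee_q_bernoulli q lq r w ws n =
           (if n < r then 0
            else (- 1) ^ r * (\<Prod>i=1..r. ws i) * (fact n / fact (n - r)) * q_moment q lq r w ws (n - r))"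
proof -
  let ?B = "\<lambda>n. if n < r then 0
    else (- 1) ^ r * (\<Prod>i=1..r. ws i) * (fact n / fact (n - r)) * q_moment q lq r w ws (n - r)"
  have "changhee_q_bernoulli q lq r w ws = ?B"
    unfolding changhee_q_bernoulli_def
  proof (rule the_equality)
    show B: "\<forall>t. (\<lambda>n. ?B n * t ^ n / fact n) sums changhee_gen_fun q lq r w ws t"
      using changhee_gen_fun_sums[OF assms] by blast
    fix B'
    assume "\<forall>t. (\<lambda>n. B' n * t ^ n / fact n) sums changhee_gen_fun q lq r w ws t"
    with B have "(\<lambda>n. B' n / fact n) = (\<lambda>n. ?B n / fact n)"
      by (intro powser_coeffs_unique[where f = "changhee_gen_fun q lq r w ws"]) simp_all
    then show "B' = ?B"
      by (metis (no_types, lifting) ext divide_cancel_right fact_nonzero)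
  qed
  then show ?thesis
    by simp
qed

text \<open>
  The case \<open>z = 0\<close> and \<open>k = 0\<close> is where \<open>complex_power\<close> departs from \<open>powr\<close>; it arises at \<open>s = 0\<close>
  when one of the \<open>q\<close>-numbers vanishes.
\<close>
lemma complex_power_of_nat: "complex_power z (of_nat k) = z ^ k"
  by (cases "z = 0 \<and> k = 0") (auto simp: complex_power_def powr_nat')

lemma changhee_q_zeta_eq_moment:
  assumes "n \<ge> 1"
  shows "changhee_q_zeta q lq r (1 - of_nat n) w ws =
           (\<Prod>i=1..r. ws i) * q_moment q lq r w ws (n - 1)"
proof -
  have "- (1 - of_nat n) = (of_nat (n - 1) :: complex)"
    using assms by (simp add: of_nat_diff)
  then show ?thesis
    by (simp only: changhee_q_zeta_def q_moment_def complex_power_of_nat)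
qed

theorem theorem12:
  fixes q lq w :: complex and ws :: "nat \<Rightarrow> complex" and r n :: nat
  assumes "0 < norm q" and "norm q < 1"
    and "exp lq = q"
    and "Re w > 0"
    and "\<forall>i\<in>{1..r}. ws i \<noteq> 0"
    and "\<forall>i\<in>{1..r}. norm (q_pow lq (ws i)) < 1"
    and "r \<ge> 1" and "n \<ge> 1"
  shows "changhee_q_zeta q lq r (1 - of_nat n) w ws =
           (- 1) ^ r * (fact (n - 1) / fact (n + r - 1)) *
           changhee_q_bernoulli q lq r w ws (n + r - 1)"
proof -
  have "n + r - 1 - r = n - 1" "\<not> n + r - 1 < r"
    using assms by auto
  then show ?thesis
    \<comment> \<open>The signs \<open>(- 1) ^ r\<close> of the formula and of the Bernoulli number combine to \<open>((- 1) * (- 1)) ^ r\<close>.\<close>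
    using assms(6,8)
    by (simp add: changhee_q_zeta_eq_moment changhee_q_bernoulli_eq flip: power_mult_distrib)
qed

end
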